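(* Let $N\ge 0$, $\alpha>0$, and let $p(\theta)=\frac{\alpha}{2}+\sum_{k=0}^{N}\big(a_{2k+1}\cos(2k+1)\theta+b_{2k+1}\sin(2k+1)\theta\big)$ be a real trigonometric polynomial satisfying $p(\theta)+p''(\theta)\geq 0$ for all $\theta$, with $a_{2N+1}\neq 0$ or $b_{2N+1}\neq 0$. Let $\mathcal{C}$ be the curve parametrized by $\theta\in[-\pi,\pi]\mapsto\big(p(\theta)\cos\theta-p'(\theta)\sin\theta,\ p(\theta)\sin\theta+p'(\theta)\cos\theta\big)$ (an algebraic curve of constant width $\alpha$), and assume $\mathcal{C}$ is not a circle. Then its defining polynomial $f\in\mathbb{R}[x,y]$ has total degree $4N+4$, and moreover $\deg_x(f)=\deg_y(f)=4N+4$.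
   Context: The defining polynomial of the curve $\mathcal{C}$ is the irreducible polynomial $f\in\mathbb{R}[x,y]$, unique up to a nonzero constant factor, whose zero set is the Zariski closure of $\mathcal{C}$. $\deg_x,\deg_y$ denote partial degrees. *)

theory Defs
  imports "HOL-Analysis.Analysis" "HOL-Computational_Algebra.Polynomial"
begin

text \<open>Bivariate real polynomials f in R[x,y] are represented as elements of
  (real poly) poly: a polynomial in y whose coefficients are polynomials in x.
  This ring is isomorphic to R[x,y].\<close>

definition bpoly_eval :: "real poly poly \<Rightarrow> real \<Rightarrow> real \<Rightarrow> real" where
  "bpoly_eval f x y = poly (map_poly (\<lambda>c. poly c x) f) y"

definition deg_y :: "real poly poly \<Rightarrow> nat" where
  "deg_y f = degree f"

definition deg_x :: "real poly poly \<Rightarrow> nat" where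
  "deg_x f = Max ((\<lambda>i. degree (coeff f i)) ` {..degree f})"

definition total_degree :: "real poly poly \<Rightarrow> nat" where
  "total_degree f = Max ({degree (coeff f i) + i | i. i \<le> degree f \<and> coeff f i \<noteq> 0} \<union> {0})"

definition zero_set :: "real poly poly \<Rightarrow> (real \<times> real) set" where
  "zero_set f = {(x, y). bpoly_eval f x y = 0}"

definition zariski_closure :: "(real \<times> real) set \<Rightarrow> (real \<times> real) set" where
  "zariski_closure S = {z. \<forall>g. S \<subseteq> zero_set g \<longrightarrow> z \<in> zero_set g}"

definition defining_polynomial :: "(real \<times> real) set \<Rightarrow> real poly poly \<Rightarrow> bool" where
  "defining_polynomial C f \<longleftrightarrow> irreducible f \<and> zero_set f = zariski_closure C"

definition is_circle :: "(real \<times> real) set \<Rightarrow> bool" where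
  "is_circle C \<longleftrightarrow> (\<exists>x0 y0 r. r > 0 \<and> C = {(x, y). (x - x0)^2 + (y - y0)^2 = r^2})"

end

theory Submission
  imports Defs
    "HOL-Computational_Algebra.Polynomial_Factorial"
    "HOL-Computational_Algebra.Field_as_Ring"
    "HOL-Computational_Algebra.Fundamental_Theorem_Algebra"
begin

text \<open>For \<open>N = 0\<close> the curve is a circle, so \<open>N > 0\<close>. Put \<open>t = cis \<theta>\<close> and \<open>m = 2N + 2\<close>. The coordinates of
  the curve are Laurent polynomials \<open>X(t)\<close>, \<open>Y(t)\<close> with poles of exact order \<open>m\<close> at \<open>0\<close> and at infinity.
  Since \<open>f\<close> is irreducible, a polynomial vanishing on the curve is a multiple of \<open>f\<close>.

  Upper bound: a polynomial of degree \<open>D\<close> that vanishes at \<open>2mD + 1\<close> points of the curve vanishes on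
  the whole curve; comparing with the number of monomials of degree at most \<open>D\<close> that are
  independent modulo \<open>f\<close> gives total degree at most \<open>2m\<close>.

  Lower bound: \<open>t \<mapsto> (X(t), Y(t))\<close> is injective up to finitely many \<open>t\<close>. Indeed, at a smooth point of
  \<open>f = 0\<close> the tangent direction determines \<open>t\<^sup>2\<close>, because the normal of the curve at the parameter
  \<open>\<theta>\<close> has direction \<open>\<theta>\<close>; and \<open>t\<close>, \<open>-t\<close> are distinguished by the term \<open>\<alpha>/2\<close> of \<open>p\<close>, the only one of even
  frequency. A generic line \<open>x = const\<close> or \<open>y = const\<close> pulls back to \<open>2m\<close> simple values of \<open>t\<close>, hence
  meets \<open>f = 0\<close> in at least \<open>2m\<close> points.\<close>

section \<open>Linear and bivariate algebra\<close>

text \<open>Gaussian elimination by induction on the number of equations: an unknown with nonzero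
  coefficient in the last equation is eliminated from the others.\<close>

lemma homogeneous_system_nontrivial:
  fixes L :: "nat \<Rightarrow> 'i \<Rightarrow> 'a::field"
  assumes "finite S" "K < card S"
  shows "\<exists>c. (\<exists>s\<in>S. c s \<noteq> 0) \<and> (\<forall>k<K. (\<Sum>s\<in>S. L k s * c s) = 0)"
  using assms
proof (induction K arbitrary: S L)
  case 0
  then have "S \<noteq> {}" by auto
  then show ?case by (intro exI[of _ "\<lambda>_. 1"]) auto
next
  case (Suc K)
  show ?case
  proof (cases "\<forall>s\<in>S. L K s = 0")
    case True
    obtain c where "\<exists>s\<in>S. c s \<noteq> 0" "\<forall>k<K. (\<Sum>s\<in>S. L k s * c s) = 0"
      using Suc.IH[of S L] Suc.prems by auto
    with True show ?thesis
      by (intro exI[of _ c]) (auto simp: less_Suc_eq intro!: sum.neutral)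
  next
    case False
    then obtain s0 where s0: "s0 \<in> S" "L K s0 \<noteq> 0" by auto
    define S' where "S' = S - {s0}"
    have fin: "finite S'" and "K < card S'"
      using Suc.prems s0 by (auto simp: S'_def)
    then obtain c where c: "\<exists>s\<in>S'. c s \<noteq> 0"
      and eqs: "\<And>k. k < K \<Longrightarrow> (\<Sum>s\<in>S'. (L k s - L k s0 / L K s0 * L K s) * c s) = 0"
      using Suc.IH[of S' "\<lambda>k s. L k s - L k s0 / L K s0 * L K s"] by auto
    \<comment> \<open>The value that equation \<open>K\<close> forces on the pivot unknown
      \<open>s0\<close>.\<close>
    define r where "r = - (\<Sum>s\<in>S'. L K s * c s) / L K s0"
    define c' where "c' = c(s0 := r)"
    have sum_eq: "(\<Sum>s\<in>S. L k s * c' s) = L k s0 * r + (\<Sum>s\<in>S'. L k s * c s)" for k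
    proof -
      have "(\<Sum>s\<in>S'. L k s * c' s) = (\<Sum>s\<in>S'. L k s * c s)"
        by (rule sum.cong) (auto simp: c'_def S'_def)
      then show ?thesis
        using sum.remove[OF Suc.prems(1) s0(1), of "\<lambda>s. L k s * c' s"]
        by (simp add: c'_def S'_def)
    qed
    have "(\<Sum>s\<in>S. L k s * c' s) = 0" if "k < Suc K" for k
    proof (cases "k = K")
      case True
      then show ?thesis using s0 by (simp add: sum_eq r_def)
    next
      case False
      have "(\<Sum>s\<in>S'. (L k s - L k s0 / L K s0 * L K s) * c s)
          = (\<Sum>s\<in>S'. L k s * c s) - L k s0 / L K s0 * (\<Sum>s\<in>S'. L K s * c s)"
        by (simp add: sum_subtractf sum_distrib_left algebra_simps)
      then have "(\<Sum>s\<in>S'. L k s * c s) = L k s0 / L K s0 * (\<Sum>s\<in>S'. L K s * c s)"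
        using eqs[of k] that False by simp
      then show ?thesis unfolding sum_eq r_def by simp
    qed
    moreover have "\<exists>s\<in>S. c' s \<noteq> 0"
      using c by (auto simp: c'_def S'_def)
    ultimately show ?thesis by (intro exI[of _ c']) auto
  qed
qed

text \<open>A nonzero element \<open>r\<close> of least degree in the ideal of \<open>f\<close> and
  \<open>g\<close> divides both up to constant factors. Were \<open>r\<close> not constant,
  primality of \<open>f\<close> would give \<open>f dvd r\<close> and then \<open>f dvd g\<close>.
  With coefficients in R[x] this eliminates y.\<close>

lemma irreducible_bezout_const:
  fixes f g :: "'a::{factorial_ring_gcd,semiring_gcd_mult_normalize} poly"
  assumes f: "irreducible f" and deg: "degree f > 0" and ndvd: "\<not> f dvd g"
  obtains A B h where "h \<noteq> 0" "A * f + B * g = [:h:]"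
proof -
  define I where "I = {A * f + B * g | A B. True}"
  have I_lin: "A * u + B * v \<in> I" if uv: "u \<in> I" "v \<in> I" for A B u v
  proof -
    obtain A1 B1 A2 B2 where "u = A1 * f + B1 * g" "v = A2 * f + B2 * g"
      using uv unfolding I_def by blast
    then have "A * u + B * v = (A * A1 + B * A2) * f + (A * B1 + B * B2) * g"
      by (simp add: algebra_simps)
    then show ?thesis by (auto simp: I_def)
  qed
  have f_I: "f \<in> I" unfolding I_def by (force intro: exI[of _ 1] exI[of _ 0])
  have g_I: "g \<in> I" unfolding I_def by (force intro: exI[of _ 1] exI[of _ 0])
  have "f \<noteq> 0" using deg by auto
  define r where "r = arg_min degree (\<lambda>r. r \<in> I \<and> r \<noteq> 0)"
  have r: "r \<in> I" "r \<noteq> 0" and r_min: "\<And>s. s \<in> I \<Longrightarrow> s \<noteq> 0 \<Longrightarrow> degree r \<le> degree s"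
    using arg_min_nat_lemma[of "\<lambda>r. r \<in> I \<and> r \<noteq> 0" f degree] f_I \<open>f \<noteq> 0\<close>
    by (auto simp: r_def)
  have dvd: "\<exists>c. c \<noteq> 0 \<and> r dvd smult c u" if "u \<in> I" for u
  proof -
    \<comment> \<open>The coefficients need not form a field; pseudo-division costs only the
      constant factor \<open>c\<close>.\<close>
    obtain q s where qs: "pseudo_divmod u r = (q, s)" by fastforce
    define c where "c = lead_coeff r ^ (Suc (degree u) - degree r)"
    have eq: "smult c u = r * q + s" and s: "s = 0 \<or> degree s < degree r"
      using pseudo_divmod[OF r(2) qs] by (auto simp: c_def)
    have "s = [:c:] * u + (- q) * r" using eq by (simp add: algebra_simps)
    then have "s \<in> I" using I_lin[OF that r(1)] by metis
    then have "s = 0" using r_min[of s] s by fastforce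
    moreover have "c \<noteq> 0" using r(2) by (simp add: c_def)
    ultimately show ?thesis using eq by (auto intro!: exI[of _ c])
  qed
  have prime: "prime_elem f" using f by (simp add: prime_elem_iff_irreducible)
  have const_ndvd: "\<not> f dvd [:c:]" if "c \<noteq> 0" for c
    using dvd_imp_degree_le[of f "[:c:]"] deg that by auto
  have "degree r = 0"
  proof (rule ccontr)
    assume nz: "degree r \<noteq> 0"
    obtain c q where c: "c \<noteq> 0" and q: "smult c f = r * q"
      using dvd[OF f_I] unfolding dvd_def by blast
    have "f dvd r * q" by (metis q dvd_smult dvd_refl)
    then have "f dvd r"
    proof (rule disjE[OF prime_elem_dvd_multD[OF prime]])
      \<comment> \<open>Cancelling \<open>f\<close> would make \<open>r\<close> divide a nonzero
        constant, against its positive degree.\<close>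
      assume "f dvd q"
      then obtain q' where "q = f * q'" by (auto elim: dvdE)
      then have "f * [:c:] = f * (r * q')" using q by (simp add: algebra_simps)
      then have "[:c:] = r * q'" using \<open>f \<noteq> 0\<close> by (simp only: mult_cancel_left) auto
      then have "r dvd [:c:]" by simp
      then show ?thesis using dvd_imp_degree_le[of r "[:c:]"] c nz by auto
    qed
    moreover obtain c' where c': "c' \<noteq> 0" "r dvd smult c' g" using dvd[OF g_I] by auto
    ultimately have "f dvd [:c':] * g" by (auto intro: dvd_trans)
    then show False
      using prime_elem_dvd_multD[OF prime] const_ndvd[OF c'(1)] ndvd by blast
  qed
  then obtain h where "r = [:h:]" by (auto elim: degree_eq_zeroE)
  with r show ?thesis using that by (auto simp: I_def)
qed

section \<open>Evaluation of real polynomials at complex points\<close>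

definition cpoly :: "real poly \<Rightarrow> complex \<Rightarrow> complex" where
  "cpoly c u = poly (map_poly of_real c) u"

lemma cpoly_0 [simp]: "cpoly 0 u = 0"
  by (simp add: cpoly_def)

lemma cpoly_pCons [simp]: "cpoly (pCons a c) u = of_real a + u * cpoly c u"
  by (simp add: cpoly_def map_poly_pCons)

lemma cpoly_add [simp]: "cpoly (c + d) u = cpoly c u + cpoly d u"
  by (induction c d rule: poly_induct2) (auto simp: algebra_simps)

lemma cpoly_smult [simp]: "cpoly (smult a c) u = of_real a * cpoly c u"
  by (induction c) (auto simp: algebra_simps)

lemma cpoly_mult [simp]: "cpoly (c * d) u = cpoly c u * cpoly d u"
  by (induction c) (auto simp: algebra_simps)

lemma cpoly_of_real: "cpoly c (of_real x) = of_real (poly c x)"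
  by (induction c) auto

lemma cpoly_monom [simp]: "cpoly (monom a i) u = of_real a * u ^ i"
  by (simp add: cpoly_def map_poly_monom poly_monom)

lemma cpoly_sum: "cpoly (\<Sum>s\<in>S. F s) u = (\<Sum>s\<in>S. cpoly (F s) u)"
  by (induction S rule: infinite_finite_induct) auto

lemma finite_cpoly_roots:
  assumes "c \<noteq> 0"
  shows "finite {u. cpoly c u = 0}"
proof -
  have "map_poly complex_of_real c \<noteq> 0" using assms by (simp add: map_poly_eq_0_iff)
  then show ?thesis unfolding cpoly_def by (rule poly_roots_finite)
qed

lemma has_field_derivative_cpoly:
  "(cpoly c has_field_derivative cpoly (pderiv c) u) (at u)"
proof (induction c)
  case (pCons a c)
  show ?case unfolding cpoly_pCons pderiv_pCons
    by (auto intro!: derivative_eq_intros pCons.IH)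
qed simp

definition ceval :: "real poly poly \<Rightarrow> complex \<Rightarrow> complex \<Rightarrow> complex" where
  "ceval f u v = poly (map_poly (\<lambda>c. cpoly c u) f) v"

lemma ceval_0 [simp]: "ceval 0 u v = 0"
  by (simp add: ceval_def)

lemma ceval_pCons [simp]: "ceval (pCons c f) u v = cpoly c u + v * ceval f u v"
  by (simp add: ceval_def map_poly_pCons)

lemma ceval_add [simp]: "ceval (f + g) u v = ceval f u v + ceval g u v"
  by (induction f g rule: poly_induct2) (auto simp: algebra_simps)

lemma ceval_smult [simp]: "ceval (smult c f) u v = cpoly c u * ceval f u v"
  by (induction f) (auto simp: algebra_simps)

lemma ceval_mult [simp]: "ceval (f * g) u v = ceval f u v * ceval g u v"
  by (induction f) (auto simp: algebra_simps)

lemma ceval_1 [simp]: "ceval 1 u v = 1"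
  by (simp add: one_pCons)

lemma ceval_monom [simp]: "ceval (monom c j) u v = cpoly c u * v ^ j"
  by (simp add: ceval_def map_poly_monom poly_monom)

lemma ceval_sum: "ceval (\<Sum>s\<in>S. F s) u v = (\<Sum>s\<in>S. ceval (F s) u v)"
  by (induction S rule: infinite_finite_induct) auto

lemma ceval_of_real: "ceval f (of_real x) (of_real y) = of_real (bpoly_eval f x y)"
  by (induction f) (auto simp: bpoly_eval_def map_poly_pCons cpoly_of_real)

text \<open>\<open>map_poly pderiv\<close> is the partial derivative with respect to \<open>x\<close>, and \<open>pderiv\<close> the one with
  respect to \<open>y\<close>.\<close>

lemma has_field_derivative_ceval:
  assumes "(X has_field_derivative X') (at t)" "(Y has_field_derivative Y') (at t)"
  shows "((\<lambda>t. ceval f (X t) (Y t)) has_field_derivative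
           ceval (map_poly pderiv f) (X t) (Y t) * X' + ceval (pderiv f) (X t) (Y t) * Y') (at t)"
proof (induction f)
  case (pCons c f)
  have "((\<lambda>t. cpoly c (X t)) has_field_derivative cpoly (pderiv c) (X t) * X') (at t)"
    using DERIV_chain2[OF has_field_derivative_cpoly assms(1)] .
  then show ?case
    by (auto intro!: derivative_eq_intros pCons.IH assms simp: map_poly_pCons pderiv_pCons algebra_simps)
qed simp

section \<open>Monomials, degrees and leading monomials\<close>

definition supp :: "real poly poly \<Rightarrow> (nat \<times> nat) set" where
  "supp f = {(i, j). coeff (coeff f j) i \<noteq> 0}"

definition bpoly :: "(nat \<times> nat) set \<Rightarrow> (nat \<times> nat \<Rightarrow> real) \<Rightarrow> real poly poly" where
  "bpoly S c = (\<Sum>(i, j)\<in>S. monom (monom (c (i, j)) i) j)"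

lemma finite_supp: "finite (supp f)"
proof -
  have "supp f \<subseteq> (\<lambda>(j, i). (i, j)) ` Sigma {..degree f} (\<lambda>j. {..degree (coeff f j)})"
  proof (clarsimp simp: supp_def)
    fix i j assume *: "coeff (coeff f j) i \<noteq> 0"
    then have "coeff f j \<noteq> 0" by auto
    then show "(i, j) \<in> (\<lambda>(j, i). (i, j)) ` Sigma {..degree f} (\<lambda>j. {..degree (coeff f j)})"
      using * by (auto intro!: image_eqI[of _ _ "(j, i)"] le_degree)
  qed
  then show ?thesis by (rule finite_subset) auto
qed

lemma coeff_bpoly:
  assumes "finite S"
  shows "coeff (coeff (bpoly S c) j) i = (if (i, j) \<in> S then c (i, j) else 0)"
proof -
  have "coeff (coeff (bpoly S c) j) i = (\<Sum>s\<in>S. if s = (i, j) then c s else 0)"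
    unfolding bpoly_def coeff_sum
    by (intro sum.cong) (auto simp: coeff_monom split: prod.splits)
  then show ?thesis using assms by simp
qed

lemma bpoly_supp: "bpoly (supp f) (\<lambda>(i, j). coeff (coeff f j) i) = f"
  by (intro poly_eqI) (auto simp: coeff_bpoly[OF finite_supp], auto simp: supp_def)

lemma ceval_bpoly: "ceval (bpoly S c) u v = (\<Sum>(i, j)\<in>S. of_real (c (i, j)) * u ^ i * v ^ j)"
  unfolding bpoly_def ceval_sum by (intro sum.cong) auto

lemma ceval_supp:
  "ceval f u v = (\<Sum>(i, j)\<in>supp f. of_real (coeff (coeff f j) i) * u ^ i * v ^ j)"
proof -
  have "ceval f u v = ceval (bpoly (supp f) (\<lambda>(i, j). coeff (coeff f j) i)) u v"
    by (simp only: bpoly_supp)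
  then show ?thesis by (simp add: ceval_bpoly)
qed

lemma bpoly_eval_bpoly: "bpoly_eval (bpoly S c) x y = (\<Sum>(i, j)\<in>S. x ^ i * y ^ j * c (i, j))"
proof -
  have "of_real (bpoly_eval (bpoly S c) x y) = (of_real (\<Sum>(i, j)\<in>S. x ^ i * y ^ j * c (i, j)) :: complex)"
    unfolding ceval_of_real[symmetric] ceval_bpoly of_real_sum
    by (intro sum.cong) (auto split: prod.splits)
  then show ?thesis by (simp only: of_real_eq_iff)
qed

lemma supp_empty_iff: "supp f = {} \<longleftrightarrow> f = 0"
  by (auto simp: supp_def poly_eq_iff)

text \<open>The largest x-exponent beside a given power of y is the degree of that coefficient, so
  the two maxima agree; the inserted 0 covers the zero polynomial.\<close>

lemma total_degree_supp: "total_degree f = Max (insert 0 ((\<lambda>(i, j). i + j) ` supp f))"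
proof -
  let ?T = "{degree (coeff f i) + i | i. i \<le> degree f \<and> coeff f i \<noteq> 0} \<union> {0}"
  let ?U = "insert 0 ((\<lambda>(i, j). i + j) ` supp f)"
  have T_eq: "?T = (\<lambda>i. degree (coeff f i) + i) ` {i. i \<le> degree f \<and> coeff f i \<noteq> 0} \<union> {0}"
    by auto
  have fT: "finite ?T" unfolding T_eq by (intro finite_UnI finite_imageI) auto
  have fU: "finite ?U" using finite_supp by auto
  have sub: "?T \<subseteq> ?U"
  proof
    fix x assume "x \<in> ?T"
    then show "x \<in> ?U"
      by (force simp: supp_def image_iff)
  qed
  have "\<exists>y\<in>?T. x \<le> y" if x: "x \<in> ?U" for x
  proof (cases "x = 0")
    case False
    then obtain i j where ij: "x = i + j" "coeff (coeff f j) i \<noteq> 0" using x unfolding supp_def by auto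
    then have "coeff f j \<noteq> 0" "i \<le> degree (coeff f j)" by (auto intro: le_degree)
    then show ?thesis using ij by (intro bexI[of _ "degree (coeff f j) + j"]) (auto intro: le_degree)
  qed auto
  then have le: "Max ?U \<le> Max ?T" using fT fU
    by (subst Max_le_iff) (auto intro: order_trans[OF _ Max_ge[OF fT]] simp del: Un_insert_right)
  have "Max ?T \<le> Max ?U" by (rule Max_mono[OF sub _ fU]) auto
  from antisym[OF this le] show ?thesis unfolding total_degree_def .
qed

lemma supp_total_degree_le: "(i, j) \<in> supp f \<Longrightarrow> i + j \<le> total_degree f"
  unfolding total_degree_supp using finite_supp by (intro Max_ge) force+

lemma total_degree_attained:
  assumes "f \<noteq> 0"
  obtains i j where "(i, j) \<in> supp f" "i + j = total_degree f"
proof -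
  have "total_degree f \<in> insert 0 ((\<lambda>(i, j). i + j) ` supp f)"
    unfolding total_degree_supp using finite_supp by (intro Max_in) auto
  moreover obtain i j where ij: "(i, j) \<in> supp f"
    using assms supp_empty_iff[of f] by (metis equals0I surj_pair)
  ultimately show ?thesis
    using that supp_total_degree_le[OF ij] by fastforce
qed

lemma deg_y_le_total_degree: "deg_y f \<le> total_degree f"
proof (cases "f = 0")
  case False
  then have "(degree (lead_coeff f), degree f) \<in> supp f" by (auto simp: supp_def)
  then show ?thesis using supp_total_degree_le by (fastforce simp: deg_y_def)
qed (simp add: deg_y_def)

lemma degree_coeff_le_deg_x: "degree (coeff f j) \<le> deg_x f"
proof (cases "j \<le> degree f")
  case True
  then show ?thesis unfolding deg_x_def by (intro Max_ge) auto
qed (simp add: coeff_eq_0)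

lemma deg_x_le_total_degree: "deg_x f \<le> total_degree f"
proof -
  have "degree (coeff f j) \<le> total_degree f" for j
  proof (cases "coeff f j = 0")
    case False
    then have "(degree (coeff f j), j) \<in> supp f" by (auto simp: supp_def)
    then show ?thesis using supp_total_degree_le by fastforce
  qed simp
  then show ?thesis unfolding deg_x_def by (subst Max_le_iff) auto
qed

lemma exists_leading_monomial:
  assumes "f \<noteq> 0"
  obtains a b where "(a, b) \<in> supp f" "a + b = total_degree f"
    "\<And>i j. (i, j) \<in> supp f \<Longrightarrow> i + j = a + b \<Longrightarrow> j \<le> b"
proof -
  define B where "B = snd ` {s \<in> supp f. fst s + snd s = total_degree f}"
  have fin: "finite B" unfolding B_def using finite_supp by auto
  obtain i j where "(i, j) \<in> supp f" "i + j = total_degree f"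
    using total_degree_attained[OF assms] .
  then have "B \<noteq> {}" unfolding B_def by force
  then have "Max B \<in> B" using fin by auto
  then obtain a where a: "(a, Max B) \<in> supp f" "a + Max B = total_degree f" by (auto simp: B_def)
  show ?thesis
  proof (rule that[OF a])
    fix i j assume "(i, j) \<in> supp f" "i + j = a + Max B"
    then have "j \<in> B" using a by (force simp: B_def)
    then show "j \<le> Max B" using fin by auto
  qed
qed

text \<open>Leading monomials are taken with respect to the graded lexicographic order.\<close>

lemma leading_monomial_mult:
  assumes f: "(a, b) \<in> supp f" "a + b = total_degree f"
      "\<And>i j. (i, j) \<in> supp f \<Longrightarrow> i + j = a + b \<Longrightarrow> j \<le> b"
    and g: "(a', b') \<in> supp g" "a' + b' = total_degree g"
      "\<And>i j. (i, j) \<in> supp g \<Longrightarrow> i + j = a' + b' \<Longrightarrow> j \<le> b'"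
  shows "(a + a', b + b') \<in> supp (f * g)"
proof -
  let ?t = "\<lambda>(j, i). coeff (coeff f j) i * coeff (coeff g (b + b' - j)) (a + a' - i)"
  \<comment> \<open>A further nonzero term needs top total degree in both factors and then a
    y-exponent maximal in both, which leaves only the product of the leading terms.\<close>
  have term0: "?t (j, i) = 0" if "j \<le> b + b'" "i \<le> a + a'" "(j, i) \<noteq> (b, a)" for i j
  proof (rule ccontr)
    assume "\<not> ?thesis"
    then have s: "(i, j) \<in> supp f" "(a + a' - i, b + b' - j) \<in> supp g" by (auto simp: supp_def)
    then have "i + j \<le> a + b" "(a + a' - i) + (b + b' - j) \<le> a' + b'"
      using supp_total_degree_le f(2) g(2) by metis+
    then have e: "i + j = a + b" "(a + a' - i) + (b + b' - j) = a' + b'" using that by linarith+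
    have "j \<le> b" "b + b' - j \<le> b'" using f(3)[OF s(1) e(1)] g(3)[OF s(2) e(2)] by auto
    then show False using e that by auto
  qed
  have "coeff (coeff (f * g) (b + b')) (a + a')
      = (\<Sum>j\<le>b + b'. \<Sum>i\<le>a + a'. coeff (coeff f j) i * coeff (coeff g (b + b' - j)) (a + a' - i))"
    by (simp add: coeff_mult coeff_sum)
  also have "\<dots> = sum ?t ({..b + b'} \<times> {..a + a'})"
    by (simp add: sum.cartesian_product)
  also have "\<dots> = sum ?t {(b, a)}"
    using term0 by (intro sum.mono_neutral_right) (simp, simp, blast)
  also have "\<dots> = coeff (coeff f b) a * coeff (coeff g b') a'" by simp
  also have "\<dots> \<noteq> 0" using f(1) g(1) by (simp add: supp_def)
  finally show ?thesis by (simp add: supp_def)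
qed

section \<open>Curves parametrized by Laurent polynomials\<close>

definition laurent :: "nat \<Rightarrow> complex poly \<Rightarrow> complex \<Rightarrow> complex" where
  "laurent m R t = poly R t / t ^ m"

text \<open>The numerator of \<open>t X'(t)\<close> over the denominator \<open>t^m\<close>, where \<open>X(t) = R(t) / t^m\<close>.\<close>

definition laurent_diff :: "nat \<Rightarrow> complex poly \<Rightarrow> complex poly" where
  "laurent_diff m R = pCons 0 (pderiv R) - smult (of_nat m) R"

lemma has_field_derivative_laurent:
  assumes "t \<noteq> 0"
  shows "(laurent m R has_field_derivative poly (laurent_diff m R) t / t ^ (m + 1)) (at t)"
proof (cases m)
  case 0
  then show ?thesis using assms unfolding laurent_def laurent_diff_def
    by (auto intro!: derivative_eq_intros poly_DERIV)
next
  case (Suc k)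
  have "(laurent m R has_field_derivative
      (poly (pderiv R) t * t ^ m - poly R t * (of_nat m * t ^ (m - 1))) / (t ^ m * t ^ m)) (at t)"
    unfolding laurent_def using assms
    by (auto intro!: derivative_eq_intros poly_DERIV simp: power2_eq_square)
  also have "(poly (pderiv R) t * t ^ m - poly R t * (of_nat m * t ^ (m - 1))) / (t ^ m * t ^ m)
      = poly (laurent_diff m R) t / t ^ (m + 1)"
    using assms by (simp add: laurent_diff_def Suc field_simps)
  finally show ?thesis .
qed

text \<open>The conditions say that \<open>R(t) / t^m\<close> has poles of exact order
  \<open>m\<close> at 0 and at infinity, so it is a map of degree \<open>2 * m\<close> on the
  Riemann sphere.\<close>

locale balanced_laurent =
  fixes m :: nat and R :: "complex poly"
  assumes m_pos: "m > 0" and degree_R: "degree R = 2 * m" and R_0: "poly R 0 \<noteq> 0"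
begin

definition fibre :: "complex \<Rightarrow> complex set" where
  "fibre u = {t. t \<noteq> 0 \<and> laurent m R t = u}"

definition fibre_poly :: "complex \<Rightarrow> complex poly" where
  "fibre_poly u = R - monom u m"

lemma degree_fibre_poly: "degree (fibre_poly u) = 2 * m"
proof -
  have "degree (monom u m) < degree R"
    using m_pos degree_R degree_monom_le[of u m] by linarith
  then have "degree (R + - monom u m) = degree R" by (intro degree_add_eq_left) simp
  then show ?thesis by (simp add: fibre_poly_def degree_R)
qed

lemma fibre_poly_nonzero: "fibre_poly u \<noteq> 0"
  using degree_fibre_poly[of u] m_pos by auto

text \<open>Clearing the denominator creates no root at 0, because
  \<open>poly R 0 \<noteq> 0\<close> and \<open>m > 0\<close>.\<close>

lemma fibre_eq: "fibre u = {t. poly (fibre_poly u) t = 0}"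
proof (intro set_eqI)
  fix t
  show "t \<in> fibre u \<longleftrightarrow> t \<in> {t. poly (fibre_poly u) t = 0}"
  proof (cases "t = 0")
    case True
    then show ?thesis using m_pos R_0 by (simp add: fibre_def fibre_poly_def poly_monom power_0_left)
  next
    case False
    then show ?thesis by (simp add: fibre_def fibre_poly_def laurent_def poly_monom divide_eq_eq)
  qed
qed

lemma finite_fibre: "finite (fibre u)"
  unfolding fibre_eq by (rule poly_roots_finite[OF fibre_poly_nonzero])

lemma finite_laurent_diff_zeros: "finite {t. poly (laurent_diff m R) t = 0}"
proof (rule poly_roots_finite)
  obtain k where k: "2 * m = Suc k" using m_pos by (cases "2 * m") auto
  have "coeff (laurent_diff m R) (2 * m) = of_nat (2 * m) * lead_coeff R - of_nat m * lead_coeff R"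
    by (simp add: laurent_diff_def degree_R coeff_pCons coeff_pderiv k)
  also have "\<dots> = of_nat m * lead_coeff R" by (simp add: algebra_simps)
  also have "\<dots> \<noteq> 0" using m_pos fibre_poly_nonzero[of 0] by (simp add: fibre_poly_def)
  finally show "laurent_diff m R \<noteq> 0" by auto
qed

text \<open>At a root of \<open>fibre_poly u\<close>, t times its derivative equals
  \<open>laurent_diff m R\<close>; without critical points in the fibre all \<open>2 * m\<close>
  roots are simple.\<close>

lemma card_fibre:
  assumes "\<And>t. t \<in> fibre u \<Longrightarrow> poly (laurent_diff m R) t \<noteq> 0"
  shows "card (fibre u) = 2 * m"
proof -
  let ?F = "fibre_poly u"
  have "rsquarefree ?F"
    unfolding rsquarefree_roots
  proof (intro allI notI, elim conjE)
    fix t assume t: "poly ?F t = 0" "poly (pderiv ?F) t = 0"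
    then have mem: "t \<in> fibre u" by (simp add: fibre_eq)
    obtain k where k: "m = Suc k" using m_pos gr0_implies_Suc by blast
    have "t * (of_nat m * (u * t ^ (m - 1))) = of_nat m * (u * t ^ m)" by (simp add: k)
    then have "poly (laurent_diff m R) t = t * poly (pderiv ?F) t - of_nat m * poly ?F t"
      by (simp add: laurent_diff_def fibre_poly_def pderiv_diff pderiv_monom poly_monom algebra_simps)
    then show False using assms[OF mem] t by simp
  qed
  then have "?F = smult (lead_coeff ?F) (\<Prod>z\<in>fibre u. [:-z, 1:])"
    using complex_poly_decompose_rsquarefree[of ?F] by (simp add: fibre_eq)
  then have "degree ?F = degree (\<Prod>z\<in>fibre u. [:-z, 1:])"
    using fibre_poly_nonzero by (metis degree_smult_eq leading_coeff_0_iff)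
  also have "\<dots> = card (fibre u)" by (subst degree_prod_sum_eq) auto
  finally show ?thesis by (simp add: degree_fibre_poly)
qed

end

text \<open>The tangent identity says that the slope of the curve at the parameter \<open>t\<close> is a
  fractional linear function of \<open>t\<^sup>2\<close>.\<close>

locale laurent_curve =
  P: balanced_laurent m P + Q: balanced_laurent m Q for m :: nat and P Q :: "complex poly" +
  fixes x y :: "real \<Rightarrow> real"
  assumes even_m: "even m"
    and tangent: "\<And>t. (1 + t\<^sup>2) * poly (laurent_diff m P) t = \<i> * (t\<^sup>2 - 1) * poly (laurent_diff m Q) t"
    and antipodal: "\<And>t. t \<noteq> 0 \<Longrightarrow> poly P (- t) = poly P t \<Longrightarrow> poly Q (- t) \<noteq> poly Q t"
    and laurent_cis_P: "\<And>\<theta>. laurent m P (cis \<theta>) = of_real (x \<theta>)"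
    and laurent_cis_Q: "\<And>\<theta>. laurent m Q (cis \<theta>) = of_real (y \<theta>)"
begin

section \<open>Polynomials vanishing on the parametrized curve\<close>

abbreviation "X \<equiv> laurent m P"
abbreviation "Y \<equiv> laurent m Q"

definition curve :: "(real \<times> real) set" where
  "curve = (\<lambda>\<theta>. (x \<theta>, y \<theta>)) ` {-pi..pi}"

text \<open>Stated for all nonzero complex t, so that roots can be counted;
  \<open>vanishes_iff_curve\<close> returns to the real points.\<close>

definition vanishes :: "real poly poly \<Rightarrow> bool" where
  "vanishes g \<longleftrightarrow> (\<forall>t. t \<noteq> 0 \<longrightarrow> ceval g (X t) (Y t) = 0)"

lemma vanishesD: "vanishes g \<Longrightarrow> t \<noteq> 0 \<Longrightarrow> ceval g (X t) (Y t) = 0"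
  by (simp add: vanishes_def)

text \<open>The factor \<open>t ^ (m * D)\<close> turns X^i Y^j into P^i Q^j t^(m(D - i - j)), of
  degree at most 2mD when i + j \<le> D.\<close>

lemma clear_denominators:
  assumes D: "total_degree g \<le> D"
  obtains R where "degree R \<le> 2 * m * D"
    "\<And>t. t \<noteq> 0 \<Longrightarrow> poly R t = t ^ (m * D) * ceval g (X t) (Y t)"
proof
  define R where "R = (\<Sum>(i, j)\<in>supp g. smult (of_real (coeff (coeff g j) i))
                        (P ^ i * Q ^ j * monom 1 (m * (D - (i + j)))))"
  have ij: "i + j \<le> D" if "(i, j) \<in> supp g" for i j
    using supp_total_degree_le[OF that] D by linarith
  show "degree R \<le> 2 * m * D"
    unfolding R_def
  proof (intro degree_sum_le finite_supp, clarify)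
    fix i j assume s: "(i, j) \<in> supp g"
    have "degree (P ^ i * Q ^ j * monom (1::complex) (m * (D - (i + j))))
        \<le> degree (P ^ i) + degree (Q ^ j) + degree (monom (1::complex) (m * (D - (i + j))))"
      by (intro order_trans[OF degree_mult_le] add_mono degree_mult_le) auto
    also have "\<dots> \<le> 2 * m * i + 2 * m * j + m * (D - (i + j))"
      using degree_power_le[of P i] degree_power_le[of Q j]
      by (intro add_mono) (auto simp: P.degree_R Q.degree_R intro: order_trans degree_monom_le)
    also have "\<dots> \<le> 2 * m * i + 2 * m * j + 2 * m * (D - (i + j))" by simp
    also have "\<dots> = 2 * m * (i + j + (D - (i + j)))" by (simp add: algebra_simps)
    also have "\<dots> = 2 * m * D" using ij[OF s] by simp
    finally show "degree (smult (of_real (coeff (coeff g j) i))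
                        (P ^ i * Q ^ j * monom 1 (m * (D - (i + j))))) \<le> 2 * m * D"
      using degree_smult_le order_trans by blast
  qed
  fix t :: complex assume t: "t \<noteq> 0"
  have "poly R t = (\<Sum>(i, j)\<in>supp g. t ^ (m * D) * (of_real (coeff (coeff g j) i) * X t ^ i * Y t ^ j))"
    unfolding R_def poly_sum
  proof (intro sum.cong refl, clarify)
    fix i j assume s: "(i, j) \<in> supp g"
    have "m * D = m * (D - (i + j)) + m * i + m * j"
      using ij[OF s] by (metis add_mult_distrib2 add.assoc le_add_diff_inverse2)
    then have "t ^ (m * D) = t ^ (m * (D - (i + j))) * (t ^ m) ^ i * (t ^ m) ^ j"
      by (simp add: power_add power_mult)
    then show "poly (smult (of_real (coeff (coeff g j) i)) (P ^ i * Q ^ j * monom 1 (m * (D - (i + j))))) t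
        = t ^ (m * D) * (of_real (coeff (coeff g j) i) * X t ^ i * Y t ^ j)"
      using t by (simp add: laurent_def poly_monom power_divide)
  qed
  then show "poly R t = t ^ (m * D) * ceval g (X t) (Y t)"
    by (simp add: ceval_supp[of g] sum_distrib_left case_prod_unfold)
qed

lemma vanishesI_card:
  assumes "total_degree g \<le> D" "2 * m * D < card T" "0 \<notin> T"
    and zero: "\<And>t. t \<in> T \<Longrightarrow> ceval g (X t) (Y t) = 0"
  shows "vanishes g"
proof -
  obtain R where R: "degree R \<le> 2 * m * D"
    "\<And>t. t \<noteq> 0 \<Longrightarrow> poly R t = t ^ (m * D) * ceval g (X t) (Y t)"
    using clear_denominators[OF assms(1)] by blast
  have "R = 0"
  proof (rule ccontr)
    assume "R \<noteq> 0"
    have "T \<subseteq> {t. poly R t = 0}"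
    proof
      fix t assume "t \<in> T"
      moreover from this have "t \<noteq> 0" using assms(3) by metis
      ultimately show "t \<in> {t. poly R t = 0}" using R(2)[of t] zero[of t] by simp
    qed
    then have "card T \<le> card {t. poly R t = 0}" by (intro card_mono poly_roots_finite \<open>R \<noteq> 0\<close>)
    also have "\<dots> \<le> degree R" by (rule card_poly_roots_bound[OF \<open>R \<noteq> 0\<close>])
    finally have "card T \<le> degree R" .
    then show False using R(1) assms(2) by linarith
  qed
  then show ?thesis unfolding vanishes_def using R(2) by force
qed

lemma vanishesI_infinite:
  assumes "infinite {t. t \<noteq> 0 \<and> ceval g (X t) (Y t) = 0}"
  shows "vanishes g"
proof -
  obtain T where "card T = Suc (2 * m * total_degree g)" "T \<subseteq> {t. t \<noteq> 0 \<and> ceval g (X t) (Y t) = 0}"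
    using infinite_arbitrarily_large[OF assms] by blast
  then show ?thesis by (intro vanishesI_card[of g "total_degree g" T]) auto
qed

lemma inj_on_cis: "inj_on cis {0..1}"
proof (rule inj_onI)
  fix a b :: real assume ab: "a \<in> {0..1}" "b \<in> {0..1}" "cis a = cis b"
  have "0 \<le> a" "a \<le> pi" "0 \<le> b" "b \<le> pi" using ab pi_gt3 by auto
  moreover have "cos a = cos b" using arg_cong[OF ab(3), of Re] by simp
  ultimately show "a = b" by (rule cos_inj_pi)
qed

text \<open>Parameters on the unit circle give the real points, and infinitely many zeros force a
  Laurent polynomial to vanish.\<close>

lemma vanishes_iff_curve: "vanishes g \<longleftrightarrow> curve \<subseteq> zero_set g"
proof
  assume "vanishes g"
  then have "ceval g (of_real (x \<theta>)) (of_real (y \<theta>)) = 0" for \<theta>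
    using vanishesD[of g "cis \<theta>"] by (simp add: laurent_cis_P laurent_cis_Q)
  then show "curve \<subseteq> zero_set g"
    by (auto simp: curve_def zero_set_def ceval_of_real)
next
  assume "curve \<subseteq> zero_set g"
  then have "(x \<theta>, y \<theta>) \<in> zero_set g" if "\<theta> \<in> {-pi..pi}" for \<theta>
    using that by (auto simp: curve_def)
  then have "ceval g (X (cis \<theta>)) (Y (cis \<theta>)) = 0" if "\<theta> \<in> {0..1}" for \<theta>
    using that pi_gt3 by (simp add: laurent_cis_P laurent_cis_Q ceval_of_real zero_set_def)
  then have "cis ` {0..1} \<subseteq> {t. t \<noteq> 0 \<and> ceval g (X t) (Y t) = 0}" by auto
  moreover have "infinite (cis ` {0..1})"
    using finite_imageD[OF _ inj_on_cis] infinite_Icc[of 0 "1::real"] by auto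
  ultimately show "vanishes g" using vanishesI_infinite infinite_super by blast
qed

text \<open>There are more unknown coefficients than sample conditions. Sampling on the unit circle,
  where X and Y are real, keeps the linear system real.\<close>

lemma exists_vanishing_supported:
  assumes S: "finite S" "\<And>i j. (i, j) \<in> S \<Longrightarrow> i + j \<le> D" and card: "2 * m * D + 1 < card S"
  obtains g where "g \<noteq> 0" "supp g \<subseteq> S" "vanishes g"
proof -
  \<comment> \<open>One sample more than the \<open>2 * m * D\<close> zeros possible for a nonzero
    numerator.\<close>
  define K where "K = 2 * m * D + 1"
  \<comment> \<open>These nodes lie in [0, 1), where \<open>inj_on_cis\<close> separates
    them.\<close>
  define \<theta> where "\<theta> k = real k / real K" for k
  have inj: "inj_on (\<lambda>k. cis (\<theta> k)) {..<K}"
  proof (rule inj_onI)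
    fix k l assume "k \<in> {..<K}" "l \<in> {..<K}" "cis (\<theta> k) = cis (\<theta> l)"
    then show "k = l" using inj_onD[OF inj_on_cis, of "\<theta> k" "\<theta> l"] by (simp add: \<theta>_def)
  qed
  obtain c where c: "\<exists>s\<in>S. c s \<noteq> 0"
    and eqs: "\<forall>k<K. (\<Sum>s\<in>S. (case s of (i, j) \<Rightarrow> x (\<theta> k) ^ i * y (\<theta> k) ^ j) * c s) = 0"
    using homogeneous_system_nontrivial[OF S(1), of K "\<lambda>k (i, j). x (\<theta> k) ^ i * y (\<theta> k) ^ j"] card
    by (auto simp: K_def)
  define g where "g = bpoly S c"
  have supp_g: "supp g \<subseteq> S" by (auto simp: g_def supp_def coeff_bpoly[OF S(1)] split: if_splits)
  obtain i0 j0 where "(i0, j0) \<in> S" "c (i0, j0) \<noteq> 0" using c by auto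
  then have "coeff (coeff g j0) i0 \<noteq> 0" by (simp add: g_def coeff_bpoly[OF S(1)])
  then have g_nz: "g \<noteq> 0" by auto
  obtain i j where "(i, j) \<in> supp g" "i + j = total_degree g" using total_degree_attained[OF g_nz] .
  then have deg: "total_degree g \<le> D" using S(2)[of i j] supp_g by auto
  have "bpoly_eval g (x (\<theta> k)) (y (\<theta> k)) = 0" if "k < K" for k
    using eqs that by (simp add: g_def bpoly_eval_bpoly case_prod_unfold)
  then have "vanishes g"
    by (intro vanishesI_card[OF deg, of "(\<lambda>k. cis (\<theta> k)) ` {..<K}"])
      (auto simp: card_image[OF inj] laurent_cis_P laurent_cis_Q ceval_of_real, simp add: K_def)
  then show ?thesis using that g_nz supp_g by blast
qed

section \<open>The irreducible equation of the curve\<close>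

lemma finite_cpoly_X:
  assumes "c \<noteq> 0"
  shows "finite {t. t \<noteq> 0 \<and> cpoly c (X t) = 0}"
proof -
  have "{t. t \<noteq> 0 \<and> cpoly c (X t) = 0} = (\<Union>u\<in>{u. cpoly c u = 0}. P.fibre u)"
    by (auto simp: P.fibre_def)
  then show ?thesis using finite_cpoly_roots[OF assms] P.finite_fibre by auto
qed

lemma infinite_punctured_plane: "infinite {t::complex. t \<noteq> 0}"
proof -
  have "{t::complex. t \<noteq> 0} = UNIV - {0}" by auto
  then show ?thesis using infinite_remove[OF infinite_UNIV_char_0[where 'a = complex]] by metis
qed

text \<open>A constant in y is a polynomial in x alone, and its zeros pull back to finitely many
  finite fibres of X.\<close>

lemma not_vanishes_const:
  assumes "c \<noteq> 0"
  shows "\<not> vanishes [:c:]"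
proof
  assume "vanishes [:c:]"
  then have "{t. t \<noteq> 0} = {t. t \<noteq> 0 \<and> cpoly c (X t) = 0}" by (auto simp: vanishes_def)
  then show False using finite_cpoly_X[OF assms] infinite_punctured_plane by simp
qed

lemma degree_pos_if_vanishes:
  assumes "f \<noteq> 0" "vanishes f"
  shows "degree f > 0"
proof (rule ccontr)
  assume "\<not> degree f > 0"
  then obtain c where "f = [:c:]" by (auto elim: degree_eq_zeroE)
  then show False using assms not_vanishes_const[of c] by auto
qed

text \<open>Otherwise the Bezout identity yields a nonzero polynomial in x alone that vanishes on
  the curve.\<close>

lemma irreducible_vanishes_dvd:
  assumes f: "irreducible f" "vanishes f" and g: "vanishes g"
  shows "f dvd g"
proof (rule ccontr)
  assume ndvd: "\<not> f dvd g"
  have "f \<noteq> 0" using f(1) by auto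
  then have "degree f > 0" using degree_pos_if_vanishes f(2) by blast
  then obtain A B h where h: "h \<noteq> 0" "A * f + B * g = [:h:]"
    using irreducible_bezout_const[OF f(1) _ ndvd] by metis
  have "vanishes (A * f + B * g)" using f g by (simp add: vanishes_def)
  then show False using not_vanishes_const h by simp
qed

lemma exists_irreducible_vanishing:
  obtains f where "irreducible f" "vanishes f"
proof -
  \<comment> \<open>The (4m + 2)D monomials of the square outnumber the 4mD + 1 conditions for
    degree 2D.\<close>
  define D where "D = 4 * m + 2"
  obtain F where F: "F \<noteq> 0" "vanishes F"
  proof (rule exists_vanishing_supported[of "{..<D} \<times> {..<D}" "2 * D"])
    show "2 * m * (2 * D) + 1 < card ({..<D} \<times> {..<D})"
      by (simp add: D_def algebra_simps)
  qed auto
  have "F \<noteq> 0 \<longrightarrow> vanishes F \<longrightarrow> (\<exists>f. irreducible f \<and> vanishes f)"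
  proof (induction F rule: prime_divisors_induct)
    case (unit F)
    then obtain G where "1 = F * G" by (auto elim: dvdE)
    then have "ceval F u v * ceval G u v = 1" for u v by (metis ceval_1 ceval_mult)
    then show ?case unfolding vanishes_def by (metis mult_zero_left zero_neq_one)
  next
    case (factor p F)
    show ?case
    proof (intro impI)
      assume nz: "p * F \<noteq> 0" and van: "vanishes (p * F)"
      \<comment> \<open>If a product vanishes everywhere, one factor vanishes at infinitely many t,
        hence everywhere.\<close>
      have "{t. t \<noteq> 0} \<subseteq> {t. t \<noteq> 0 \<and> ceval p (X t) (Y t) = 0} \<union> {t. t \<noteq> 0 \<and> ceval F (X t) (Y t) = 0}"
        using vanishesD[OF van] by auto
      then have "infinite {t. t \<noteq> 0 \<and> ceval p (X t) (Y t) = 0} \<or> infinite {t. t \<noteq> 0 \<and> ceval F (X t) (Y t) = 0}"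
        using infinite_super[OF _ infinite_punctured_plane] infinite_Un by blast
      then have "vanishes p \<or> vanishes F" using vanishesI_infinite by blast
      then show "\<exists>f. irreducible f \<and> vanishes f"
        using factor nz by (auto intro: prime_elem_imp_irreducible)
    qed
  qed simp
  then show ?thesis using that F by blast
qed

text \<open>Every polynomial vanishing on the curve is a multiple of \<open>f\<close>, so its zero
  set contains that of \<open>f\<close>; this makes \<open>zero_set f\<close> the closure.\<close>

lemma defining_polynomial_curve_iff:
  "defining_polynomial curve f \<longleftrightarrow> irreducible f \<and> vanishes f"
proof
  assume "defining_polynomial curve f"
  moreover have "curve \<subseteq> zariski_closure curve" by (auto simp: zariski_closure_def)
  ultimately show "irreducible f \<and> vanishes f"
    by (auto simp: defining_polynomial_def vanishes_iff_curve)
next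
  assume f: "irreducible f \<and> vanishes f"
  have "z \<in> zero_set g" if z: "z \<in> zero_set f" and g: "curve \<subseteq> zero_set g" for z g
  proof -
    obtain q where "g = f * q"
      using irreducible_vanishes_dvd[of f g] f g by (auto simp: vanishes_iff_curve elim: dvdE)
    then have "complex_of_real (bpoly_eval g u v) = of_real (bpoly_eval f u v * bpoly_eval q u v)" for u v
      by (simp flip: ceval_of_real)
    then have "bpoly_eval g u v = bpoly_eval f u v * bpoly_eval q u v" for u v
      by (simp only: of_real_eq_iff)
    then show ?thesis using z by (auto simp: zero_set_def)
  qed
  then show "defining_polynomial curve f"
    using f by (auto simp: defining_polynomial_def vanishes_iff_curve zariski_closure_def)
qed

section \<open>Upper bound for the total degree\<close>

text \<open>A multiple of \<open>f\<close> cannot be supported on monomials outside the ideal generated by the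
  leading monomial \<open>x^a y^b\<close> of \<open>f\<close>, so about \<open>(a + b) D\<close> monomials of degree \<open>D\<close> are linearly
  independent on the curve, whereas the restrictions to the curve span a space of dimension
  at most \<open>2 m D + 1\<close>.\<close>

lemma total_degree_le:
  assumes f: "irreducible f" "vanishes f"
  shows "total_degree f \<le> 2 * m"
proof (rule ccontr)
  assume "\<not> ?thesis"
  then have big: "2 * m + 1 \<le> total_degree f" by simp
  have "f \<noteq> 0" using f by auto
  obtain a b where ab: "(a, b) \<in> supp f" "a + b = total_degree f"
    "\<And>i j. (i, j) \<in> supp f \<Longrightarrow> i + j = a + b \<Longrightarrow> j \<le> b"
    using exists_leading_monomial[OF \<open>f \<noteq> 0\<close>] by metis
  define d where "d = total_degree f"
  \<comment> \<open>The least value for which (2m + 1)D exceeds 2m(D + d) + 1.\<close>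
  define D where "D = 2 * m * d + 2"
  \<comment> \<open>Monomials not divisible by x^a y^b: a strip of height \<open>b\<close> and,
    above it, one of width \<open>a\<close>, both of length \<open>D\<close>.\<close>
  define S where "S = {..<D} \<times> {..<b} \<union> {..<a} \<times> {b..<b + D}"
  have "card S = D * b + a * D"
    unfolding S_def by (subst card_Un_disjoint) auto
  also have "\<dots> = d * D" using ab(2) by (simp add: d_def algebra_simps flip: ab(2))
  finally have card_S: "card S = d * D" .
  have "2 * m * (D + d) + 1 < (2 * m + 1) * D" by (simp add: D_def algebra_simps)
  also have "\<dots> \<le> d * D" using big unfolding d_def by (intro mult_right_mono) auto
  finally have "2 * m * (D + d) + 1 < card S" by (simp only: card_S)
  moreover have "finite S" by (simp add: S_def)
  moreover have "i + j \<le> D + d" if "(i, j) \<in> S" for i j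
    using that ab(2) by (auto simp: S_def d_def)
  ultimately obtain g where g: "g \<noteq> 0" "supp g \<subseteq> S" "vanishes g"
    using exists_vanishing_supported[of S "D + d"] by blast
  obtain q where q: "g = f * q"
    using irreducible_vanishes_dvd[OF f g(3)] by (auto elim: dvdE)
  then have "q \<noteq> 0" using g by auto
  \<comment> \<open>The leading monomial of \<open>f * q\<close> is divisible by x^a y^b, which
    \<open>S\<close> excludes.\<close>
  obtain a' b' where "(a', b') \<in> supp q" "a' + b' = total_degree q"
    "\<And>i j. (i, j) \<in> supp q \<Longrightarrow> i + j = a' + b' \<Longrightarrow> j \<le> b'"
    using exists_leading_monomial[OF \<open>q \<noteq> 0\<close>] by metis
  then have "(a + a', b + b') \<in> supp g"
    unfolding q using ab by (intro leading_monomial_mult) auto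
  then show False using g(2) by (auto simp: S_def)
qed

section \<open>Generic injectivity and lower bounds for the partial degrees\<close>

text \<open>At a smooth point of the curve the tangent direction is determined by \<open>f\<close>, and it
  determines \<open>t\<^sup>2\<close>; singular points are finite in number.\<close>

lemma injective_off_finite:
  assumes f: "irreducible f" "vanishes f"
  obtains T where "finite T"
    "\<forall>t\<in>- T. poly (laurent_diff m P) t \<noteq> 0 \<and> poly (laurent_diff m Q) t \<noteq> 0"
    "inj_on (\<lambda>t. (X t, Y t)) (- T)"
proof -
  have "f \<noteq> 0" using f by auto
  then have deg: "degree f > 0" using degree_pos_if_vanishes f by auto
  then have "\<not> f dvd pderiv f"
    using dvd_imp_degree_le[of f "pderiv f"] by (auto simp: pderiv_eq_0_iff degree_pderiv)
  then obtain A B h where h: "h \<noteq> 0" "A * f + B * pderiv f = [:h:]"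
    using irreducible_bezout_const[OF f(1) deg] by metis
  \<comment> \<open>Besides 0 and the critical parameters, \<open>T\<close> contains every t at
    which the y-derivative of \<open>f\<close> vanishes, since there \<open>h\<close> vanishes at
    X(t).\<close>
  define T where "T = {0} \<union> {t. poly (laurent_diff m P) t = 0} \<union> {t. poly (laurent_diff m Q) t = 0}
                    \<union> {t. t \<noteq> 0 \<and> cpoly h (X t) = 0}"
  have fin: "finite T"
    unfolding T_def using P.finite_laurent_diff_zeros Q.finite_laurent_diff_zeros finite_cpoly_X[OF h(1)]
    by simp
  have fy: "ceval (pderiv f) (X t) (Y t) \<noteq> 0" if t: "t \<notin> T" for t
  proof
    assume "ceval (pderiv f) (X t) (Y t) = 0"
    then have "ceval (A * f + B * pderiv f) (X t) (Y t) = 0"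
      using vanishesD[OF f(2)] t by (simp add: T_def)
    then show False using h t by (auto simp: T_def)
  qed
  have chain: "ceval (map_poly pderiv f) (X t) (Y t) * poly (laurent_diff m P) t
        + ceval (pderiv f) (X t) (Y t) * poly (laurent_diff m Q) t = 0" if t: "t \<noteq> 0" for t
  proof -
    let ?dP = "poly (laurent_diff m P) t / t ^ (m + 1)" and ?dQ = "poly (laurent_diff m Q) t / t ^ (m + 1)"
    have "((\<lambda>t. ceval f (X t) (Y t)) has_field_derivative
        ceval (map_poly pderiv f) (X t) (Y t) * ?dP + ceval (pderiv f) (X t) (Y t) * ?dQ) (at t)"
      by (intro has_field_derivative_ceval has_field_derivative_laurent t)
    moreover have "((\<lambda>t. ceval f (X t) (Y t)) has_field_derivative 0) (at t)"
      by (rule has_field_derivative_transform_within_open[of "\<lambda>_. 0" _ _ "- {0}"])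
        (use t vanishesD[OF f(2)] in auto)
    ultimately have "ceval (map_poly pderiv f) (X t) (Y t) * ?dP + ceval (pderiv f) (X t) (Y t) * ?dQ = 0"
      by (rule DERIV_unique)
    then have "(ceval (map_poly pderiv f) (X t) (Y t) * poly (laurent_diff m P) t
        + ceval (pderiv f) (X t) (Y t) * poly (laurent_diff m Q) t) / t ^ (m + 1) = 0"
      by (simp add: add_divide_distrib)
    then show ?thesis using t by simp
  qed
  \<comment> \<open>The ratio of the partial derivatives depends only on the point (u, v), so one
    \<open>r\<close> serves all parameters above it.\<close>
  have slope: "\<exists>r. \<forall>t. t \<notin> T \<longrightarrow> X t = u \<longrightarrow> Y t = v \<longrightarrow> 1 + t\<^sup>2 = r * (t\<^sup>2 - 1)" for u v
  proof (intro exI allI impI)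
    fix t assume t: "t \<notin> T" "X t = u" "Y t = v"
    let ?P = "poly (laurent_diff m P) t" and ?Q = "poly (laurent_diff m Q) t"
    let ?fx = "ceval (map_poly pderiv f) u v" and ?fy = "ceval (pderiv f) u v"
    have fy_nz: "?fy \<noteq> 0" using fy t by auto
    have P_nz: "?P \<noteq> 0" "t \<noteq> 0" using t by (auto simp: T_def)
    have "?fx * ?P + ?fy * ?Q = 0" using chain[OF P_nz(2)] t by simp
    then have Q_eq: "?Q = - (?fx / ?fy) * ?P" using fy_nz by (simp add: field_simps add_eq_0_iff)
    have "(1 + t\<^sup>2) * ?P = (- \<i> * (?fx / ?fy) * (t\<^sup>2 - 1)) * ?P"
      using tangent[of t] unfolding Q_eq by (simp add: algebra_simps)
    then show "1 + t\<^sup>2 = - \<i> * (?fx / ?fy) * (t\<^sup>2 - 1)" using P_nz(1) by (simp only: mult_cancel_right) simp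
  qed
  have inj: "inj_on (\<lambda>t. (X t, Y t)) (- T)"
  proof (rule inj_onI)
    fix s t assume "s \<in> - T" "t \<in> - T" "(X s, Y s) = (X t, Y t)"
    then have st: "s \<notin> T" "t \<notin> T" "X s = X t" "Y s = Y t" by auto
    then have "t \<noteq> 0" by (simp add: T_def)
    obtain r where r: "1 + s\<^sup>2 = r * (s\<^sup>2 - 1)" "1 + t\<^sup>2 = r * (t\<^sup>2 - 1)"
      using slope[of "X t" "Y t"] st by metis
    \<comment> \<open>For \<open>r = 1\<close> the equation would read 1 = -1.\<close>
    have "r \<noteq> 1" using r by auto
    have "(r - 1) * (s\<^sup>2 - t\<^sup>2) = (r * (s\<^sup>2 - 1) - (1 + s\<^sup>2)) - (r * (t\<^sup>2 - 1) - (1 + t\<^sup>2))"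
      by (simp add: algebra_simps)
    then have "(r - 1) * (s\<^sup>2 - t\<^sup>2) = 0" using r by simp
    with \<open>r \<noteq> 1\<close> have "s\<^sup>2 = t\<^sup>2" by simp
    then consider "s = t" | "s = - t" by (auto simp: power2_eq_iff)
    then show "s = t"
    proof cases
      case 2
      \<comment> \<open>As \<open>m\<close> is even, t and -t share the denominator, so equal
        coordinates mean equal numerators.\<close>
      have "poly P (- t) = poly P t" "poly Q (- t) = poly Q t"
        using st(3,4) \<open>t \<noteq> 0\<close> even_m unfolding 2 by (auto simp: laurent_def)
      then show ?thesis using antipodal[OF \<open>t \<noteq> 0\<close>] by simp
    qed
  qed
  show ?thesis by (rule that[OF fin _ inj]) (simp add: T_def)
qed

text \<open>Over a generic \<open>u\<close> the fibre of X has \<open>2 * m\<close> parameters;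
  injectivity makes their Y-values distinct, and all are roots of f(u, y).\<close>

lemma deg_y_ge:
  assumes f: "irreducible f" "vanishes f"
  shows "2 * m \<le> deg_y f"
proof -
  have "f \<noteq> 0" using f by auto
  obtain T where T: "finite T"
    "\<forall>t\<in>- T. poly (laurent_diff m P) t \<noteq> 0 \<and> poly (laurent_diff m Q) t \<noteq> 0"
    "inj_on (\<lambda>t. (X t, Y t)) (- T)"
    by (rule injective_off_finite[OF f])
  have "finite (X ` T \<union> {u. cpoly (lead_coeff f) u = 0})"
    using T(1) finite_cpoly_roots[of "lead_coeff f"] \<open>f \<noteq> 0\<close> by simp
  \<comment> \<open>This \<open>u\<close> avoids the exceptional parameters and keeps f(u, y) a
    nonzero polynomial in y.\<close>
  then obtain u where u: "u \<notin> X ` T" "cpoly (lead_coeff f) u \<noteq> 0"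
    using ex_new_if_finite[OF infinite_UNIV_char_0] by blast
  define E where "E = P.fibre u"
  have disj: "t \<notin> T" if "t \<in> E" for t using that u(1) by (auto simp: E_def P.fibre_def)
  have card_E: "card E = 2 * m" unfolding E_def using disj T(2) by (intro P.card_fibre) (auto simp: E_def)
  have inj: "inj_on Y E"
    using disj by (intro inj_onI inj_onD[OF T(3)]) (auto simp: E_def P.fibre_def)
  define F where "F = map_poly (\<lambda>c. cpoly c u) f"
  have F: "F \<noteq> 0" using u(2) by (auto simp: F_def poly_eq_iff coeff_map_poly)
  have "Y ` E \<subseteq> {v. poly F v = 0}"
    using vanishesD[OF f(2)] by (auto simp: E_def P.fibre_def F_def ceval_def)
  then have "card (Y ` E) \<le> card {v. poly F v = 0}" by (intro card_mono poly_roots_finite F)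
  also have "\<dots> \<le> degree F" by (rule card_poly_roots_bound[OF F])
  also have "\<dots> \<le> degree f" unfolding F_def by (rule map_poly_degree_leq)
  finally show ?thesis by (simp add: card_image[OF inj] card_E deg_y_def)
qed

lemma deg_x_ge:
  assumes f: "irreducible f" "vanishes f"
  shows "2 * m \<le> deg_x f"
proof -
  have "f \<noteq> 0" using f by auto
  then obtain i j where ij: "(i, j) \<in> supp f" by (rule total_degree_attained)
  obtain T where T: "finite T"
    "\<forall>t\<in>- T. poly (laurent_diff m P) t \<noteq> 0 \<and> poly (laurent_diff m Q) t \<noteq> 0"
    "inj_on (\<lambda>t. (X t, Y t)) (- T)"
    by (rule injective_off_finite[OF f])
  \<comment> \<open>The coefficient of x^i as a polynomial in y; a value \<open>v\<close> with c(v)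
    nonzero keeps f(x, v) a nonzero polynomial in x.\<close>
  define c where "c = map_poly (\<lambda>q. coeff q i) f"
  have "coeff c j \<noteq> 0" using ij by (simp add: c_def coeff_map_poly supp_def)
  then have "c \<noteq> 0" by auto
  then have "finite (Y ` T \<union> {v. cpoly c v = 0})"
    using T(1) finite_cpoly_roots[of c] by simp
  then obtain v where v: "v \<notin> Y ` T" "cpoly c v \<noteq> 0"
    using ex_new_if_finite[OF infinite_UNIV_char_0] by blast
  define E where "E = Q.fibre v"
  have disj: "t \<notin> T" if "t \<in> E" for t using that v(1) by (auto simp: E_def Q.fibre_def)
  have card_E: "card E = 2 * m" unfolding E_def using disj T(2) by (intro Q.card_fibre) (auto simp: E_def)
  have inj: "inj_on X E"
    using disj by (intro inj_onI inj_onD[OF T(3)]) (auto simp: E_def Q.fibre_def)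
  \<comment> \<open>This is f(x, v), assembled from the powers of y because x is the inner
    variable.\<close>
  define F where "F = (\<Sum>j\<le>degree f. smult (v ^ j) (map_poly of_real (coeff f j)))"
  have poly_F: "poly F u = ceval f u v" for u
  proof -
    have "ceval f u v = ceval (\<Sum>j\<le>degree f. monom (coeff f j) j) u v" by (simp add: poly_as_sum_of_monoms)
    then show ?thesis by (simp add: F_def poly_sum ceval_sum cpoly_def mult.commute)
  qed
  have "coeff F i = (\<Sum>j\<le>degree f. of_real (coeff c j) * v ^ j)"
    by (simp add: F_def coeff_sum c_def coeff_map_poly mult.commute)
  also have "\<dots> = cpoly (\<Sum>j\<le>degree f. monom (coeff c j) j) v"
    by (simp add: cpoly_sum)
  also have "(\<Sum>j\<le>degree f. monom (coeff c j) j) = c"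
    by (intro poly_as_sum_of_monoms') (simp add: c_def map_poly_degree_leq)
  finally have F: "F \<noteq> 0" using v(2) by auto
  have "X ` E \<subseteq> {u. poly F u = 0}"
    using vanishesD[OF f(2)] by (auto simp: E_def Q.fibre_def poly_F)
  then have "card (X ` E) \<le> card {u. poly F u = 0}" by (intro card_mono poly_roots_finite F)
  also have "\<dots> \<le> degree F" by (rule card_poly_roots_bound[OF F])
  also have "\<dots> \<le> deg_x f" unfolding F_def
    by (intro degree_sum_le) (auto intro: order_trans[OF degree_smult_le] order_trans[OF map_poly_degree_leq]
      degree_coeff_le_deg_x)
  finally show ?thesis by (simp add: card_image[OF inj] card_E)
qed

lemma defining_polynomial_degrees:
  "(\<exists>f. defining_polynomial curve f) \<and>
   (\<forall>f. defining_polynomial curve f \<longrightarrow> total_degree f = 2 * m \<and> deg_x f = 2 * m \<and> deg_y f = 2 * m)"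
proof (intro conjI allI impI)
  show "\<exists>f. defining_polynomial curve f"
    using exists_irreducible_vanishing defining_polynomial_curve_iff by blast
  fix f assume "defining_polynomial curve f"
  then have f: "irreducible f" "vanishes f" by (auto simp: defining_polynomial_curve_iff)
  note le = total_degree_le[OF f] deg_y_ge[OF f] deg_x_ge[OF f]
    deg_y_le_total_degree[of f] deg_x_le_total_degree[of f]
  show "total_degree f = 2 * m" "deg_x f = 2 * m" "deg_y f = 2 * m" using le by linarith+
qed

end

section \<open>The curve of a support function\<close>

text \<open>The operator is t d/dt, with eigenvalue i - m on t^(i - m).\<close>

lemma coeff_laurent_diff: "coeff (laurent_diff m R) i = (of_nat i - of_nat m) * coeff R i"
  by (cases i) (simp_all add: laurent_diff_def coeff_pderiv algebra_simps)

lemma laurent_diff_add: "laurent_diff m (R + S) = laurent_diff m R + laurent_diff m S"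
  by (simp add: poly_eq_iff coeff_laurent_diff distrib_left)

lemma laurent_diff_smult: "laurent_diff m (smult c R) = smult c (laurent_diff m R)"
  by (simp add: poly_eq_iff coeff_laurent_diff)

lemma laurent_diff_sum: "laurent_diff m (\<Sum>j\<in>J. F j) = (\<Sum>j\<in>J. laurent_diff m (F j))"
  by (simp add: poly_eq_iff coeff_laurent_diff coeff_sum sum_distrib_left)

lemma laurent_diff_monom: "laurent_diff m (monom c e) = monom ((of_nat e - of_nat m) * c) e"
  by (simp add: poly_eq_iff coeff_laurent_diff coeff_monom)

text \<open>With \<open>p(\<theta>) = c + \<Sum>\<^sub>j (\<gamma>\<^sub>j t^(2j+1) + cnj \<gamma>\<^sub>j t^-(2j+1))\<close> at \<open>t = cis \<theta>\<close>, the polynomials below are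
  \<open>t^(2N+2)\<close> times \<open>x + \<i> y = (p + \<i> p') t\<close> and \<open>x - \<i> y = (p - \<i> p') / t\<close>.\<close>

definition Zpoly :: "nat \<Rightarrow> real \<Rightarrow> (nat \<Rightarrow> complex) \<Rightarrow> complex poly" where
  "Zpoly N c \<gamma> = monom (of_real c) (2 * N + 3) +
     (\<Sum>j\<le>N. monom (- of_nat (2 * j) * \<gamma> j) (2 * N + 2 * j + 4)
          + monom (of_nat (2 * j + 2) * cnj (\<gamma> j)) (2 * (N - j) + 2))"

definition Wpoly :: "nat \<Rightarrow> real \<Rightarrow> (nat \<Rightarrow> complex) \<Rightarrow> complex poly" where
  "Wpoly N c \<gamma> = monom (of_real c) (2 * N + 1) +
     (\<Sum>j\<le>N. monom (of_nat (2 * j + 2) * \<gamma> j) (2 * N + 2 * j + 2)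
          + monom (- of_nat (2 * j) * cnj (\<gamma> j)) (2 * (N - j)))"

text \<open>For z = (p + i p') e^(i\<theta>) and its conjugate w, z' = i (p + p'') e^(i\<theta>) and
  w' = -i (p + p'') e^(-i\<theta>), with ratio -t^2. The proof compares coefficients.\<close>

lemma Zpoly_Wpoly_tangent:
  "poly (laurent_diff (2 * N + 2) (Zpoly N c \<gamma>)) t
    = - t\<^sup>2 * poly (laurent_diff (2 * N + 2) (Wpoly N c \<gamma>)) t"
proof -
  have "poly (laurent_diff (2 * N + 2) (Zpoly N c \<gamma>)) t = of_real c * t ^ (2 * N + 3) +
     (\<Sum>j\<le>N. of_nat (2 * j + 2) * (- of_nat (2 * j)) * \<gamma> j * t ^ (2 * N + 2 * j + 4)
          + (- of_nat (2 * j)) * (of_nat (2 * j + 2) * cnj (\<gamma> j)) * t ^ (2 * (N - j) + 2))"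
    unfolding Zpoly_def laurent_diff_add laurent_diff_sum laurent_diff_monom poly_add poly_sum poly_monom
    by (intro arg_cong2[where f = "(+)"] sum.cong) (auto simp: of_nat_diff algebra_simps)
  moreover have "poly (laurent_diff (2 * N + 2) (Wpoly N c \<gamma>)) t = - of_real c * t ^ (2 * N + 1) +
     (\<Sum>j\<le>N. of_nat (2 * j) * of_nat (2 * j + 2) * \<gamma> j * t ^ (2 * N + 2 * j + 2)
          + (- of_nat (2 * j + 2)) * (- of_nat (2 * j) * cnj (\<gamma> j)) * t ^ (2 * (N - j)))"
    unfolding Wpoly_def laurent_diff_add laurent_diff_sum laurent_diff_monom poly_add poly_sum poly_monom
    by (intro arg_cong2[where f = "(+)"] sum.cong) (auto simp: of_nat_diff algebra_simps)
  ultimately show ?thesis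
    by (simp only: distrib_left sum_distrib_left)
      (intro arg_cong2[where f = "(+)"] sum.cong; simp add: power_add power2_eq_square power3_eq_cube
        power4_eq_xxxx algebra_simps)
qed

text \<open>The term from \<open>c\<close> is the only one with an odd exponent.\<close>

lemma Zpoly_uminus: "poly (Zpoly N c \<gamma>) t - poly (Zpoly N c \<gamma>) (- t) = 2 * of_real c * t ^ (2 * N + 3)"
  by (simp add: Zpoly_def poly_sum poly_monom power_minus_odd)

text \<open>Only \<open>j = N\<close> reaches this exponent; the factor 2N makes the coefficient
  vanish for N = 0.\<close>

lemma coeff_Zpoly_top: "coeff (Zpoly N c \<gamma>) (4 * N + 4) = - of_nat (2 * N) * \<gamma> N"
proof -
  have "coeff (Zpoly N c \<gamma>) (4 * N + 4) = 0 + (\<Sum>j\<le>N. if j = N then - of_nat (2 * N) * \<gamma> N else 0)"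
    unfolding Zpoly_def coeff_add coeff_sum coeff_monom
    by (intro arg_cong2[where f = "(+)"] sum.cong) auto
  then show ?thesis by simp
qed

lemma coeff_Wpoly_0: "coeff (Wpoly N c \<gamma>) 0 = - of_nat (2 * N) * cnj (\<gamma> N)"
proof -
  have "coeff (Wpoly N c \<gamma>) 0 = 0 + (\<Sum>j\<le>N. if j = N then - of_nat (2 * N) * cnj (\<gamma> N) else 0)"
    unfolding Wpoly_def coeff_add coeff_sum coeff_monom
    by (intro arg_cong2[where f = "(+)"] sum.cong) auto
  then show ?thesis by simp
qed

lemma coeff_Zpoly_0: "coeff (Zpoly N c \<gamma>) 0 = 0"
  by (simp add: Zpoly_def coeff_sum)

lemma degree_Zpoly: "degree (Zpoly N c \<gamma>) \<le> 4 * N + 4"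
  unfolding Zpoly_def
  by (intro degree_add_le degree_sum_le order_trans[OF degree_monom_le]) auto

lemma degree_Wpoly: "degree (Wpoly N c \<gamma>) \<le> 4 * N + 2"
  unfolding Wpoly_def
  by (intro degree_add_le degree_sum_le order_trans[OF degree_monom_le]) auto

lemma coeff_Wpoly_top: "coeff (Wpoly N c \<gamma>) (4 * N + 4) = 0"
  using degree_Wpoly[of N c \<gamma>] by (intro coeff_eq_0) linarith

section \<open>Fourier expansion on the unit circle\<close>

lemma laurent_monom_cis:
  "laurent m (monom c e) (cis \<theta>) = c * cis ((real e - real m) * \<theta>)"
  by (simp add: laurent_def poly_monom Complex.DeMoivre left_diff_distrib flip: cis_divide)

lemma laurent_add: "laurent m (R + S) t = laurent m R t + laurent m S t"
  by (simp add: laurent_def add_divide_distrib)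

lemma laurent_sum: "laurent m (\<Sum>j\<in>J. F j) t = (\<Sum>j\<in>J. laurent m (F j) t)"
  by (simp add: laurent_def poly_sum sum_divide_distrib)

lemma laurent_smult: "laurent m (smult c R) t = c * laurent m R t"
  by (simp add: laurent_def)

lemma trig_term_eq_cis:
  fixes a b \<theta> k :: real and \<gamma> :: complex
  defines "\<gamma> \<equiv> Complex (a / 2) (- b / 2)"
  shows "complex_of_real (a * cos (k * \<theta>) + b * sin (k * \<theta>)) = \<gamma> * cis (k * \<theta>) + cnj \<gamma> * cis (- k * \<theta>)"
    and "\<i> * complex_of_real (k * (b * cos (k * \<theta>) - a * sin (k * \<theta>)))
          = - k * \<gamma> * cis (k * \<theta>) + k * cnj \<gamma> * cis (- k * \<theta>)"
  by (auto simp: \<gamma>_def complex_eq_iff algebra_simps)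

context
  fixes N :: nat and c :: real and a b :: "nat \<Rightarrow> real" and p p' :: "real \<Rightarrow> real"
    and \<gamma> :: "nat \<Rightarrow> complex"
  assumes p_eq: "\<And>\<theta>. p \<theta> = c + (\<Sum>j\<le>N. a (2*j+1) * cos (real (2*j+1) * \<theta>) + b (2*j+1) * sin (real (2*j+1) * \<theta>))"
    and p'_eq: "\<And>\<theta>. p' \<theta> = (\<Sum>j\<le>N. real (2*j+1) * (b (2*j+1) * cos (real (2*j+1) * \<theta>) - a (2*j+1) * sin (real (2*j+1) * \<theta>)))"
    and \<gamma>_eq: "\<And>j. \<gamma> j = Complex (a (2*j+1) / 2) (- b (2*j+1) / 2)"
begin

lemma laurent_Zpoly_cis:
  "laurent (2 * N + 2) (Zpoly N c \<gamma>) (cis \<theta>) = (of_real (p \<theta>) + \<i> * of_real (p' \<theta>)) * cis \<theta>"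
proof -
  have "(of_real (p \<theta>) + \<i> * of_real (p' \<theta>)) * cis \<theta> = of_real c * cis \<theta> +
    (\<Sum>j\<le>N. (of_real (a (2*j+1) * cos (real (2*j+1) * \<theta>) + b (2*j+1) * sin (real (2*j+1) * \<theta>))
      + \<i> * of_real (real (2*j+1) * (b (2*j+1) * cos (real (2*j+1) * \<theta>) - a (2*j+1) * sin (real (2*j+1) * \<theta>)))) * cis \<theta>)"
    by (simp only: p_eq p'_eq of_real_add of_real_sum sum_distrib_left sum_distrib_right sum.distrib
        distrib_right add.assoc)
  also have "\<dots> = of_real c * cis \<theta> + (\<Sum>j\<le>N. - of_nat (2 * j) * \<gamma> j * cis (real (2 * j + 2) * \<theta>)
      + of_nat (2 * j + 2) * cnj (\<gamma> j) * cis (- real (2 * j) * \<theta>))"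
  proof (intro arg_cong2[where f = "(+)"] sum.cong refl)
    fix j
    \<comment> \<open>In p + i p' the frequency 2j + 1 acquires the factor -2j and its negative the
      factor 2j + 2; multiplication by \<open>cis \<theta>\<close> then shifts both by one.\<close>
    have c1: "cis (real (2*j+1) * \<theta>) * cis \<theta> = cis (real (2 * j + 2) * \<theta>)"
      "cis (- real (2*j+1) * \<theta>) * cis \<theta> = cis (- real (2 * j) * \<theta>)"
      by (auto simp: cis_mult algebra_simps)
    show "(of_real (a (2*j+1) * cos (real (2*j+1) * \<theta>) + b (2*j+1) * sin (real (2*j+1) * \<theta>))
      + \<i> * of_real (real (2*j+1) * (b (2*j+1) * cos (real (2*j+1) * \<theta>) - a (2*j+1) * sin (real (2*j+1) * \<theta>)))) * cis \<theta>
      = - of_nat (2 * j) * \<gamma> j * cis (real (2 * j + 2) * \<theta>)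
      + of_nat (2 * j + 2) * cnj (\<gamma> j) * cis (- real (2 * j) * \<theta>)"
      unfolding trig_term_eq_cis c1[symmetric] \<gamma>_eq[symmetric] by (simp add: algebra_simps)
  qed
  also have "\<dots> = laurent (2 * N + 2) (Zpoly N c \<gamma>) (cis \<theta>)"
    unfolding Zpoly_def laurent_add laurent_sum laurent_monom_cis
    by (intro arg_cong2[where f = "(+)"] sum.cong) (auto simp: of_nat_diff algebra_simps)
  finally show ?thesis by simp
qed

text \<open>On the unit circle conjugation inverts t, so the conjugate of the Z-identity has the
  reversed, conjugated coefficients that define \<open>Wpoly\<close>.\<close>

lemma laurent_Wpoly_cis:
  "laurent (2 * N + 2) (Wpoly N c \<gamma>) (cis \<theta>) = (of_real (p \<theta>) - \<i> * of_real (p' \<theta>)) * cis (- \<theta>)"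
proof -
  have "(of_real (p \<theta>) - \<i> * of_real (p' \<theta>)) * cis (- \<theta>)
      = cnj ((of_real (p \<theta>) + \<i> * of_real (p' \<theta>)) * cis \<theta>)"
    by (simp add: cis_cnj)
  also have "\<dots> = cnj (laurent (2 * N + 2) (Zpoly N c \<gamma>) (cis \<theta>))"
    by (simp only: laurent_Zpoly_cis)
  also have "\<dots> = laurent (2 * N + 2) (Wpoly N c \<gamma>) (cis \<theta>)"
    unfolding Zpoly_def Wpoly_def laurent_add laurent_sum laurent_monom_cis complex_cnj_add cnj_sum
      sum.distrib add.assoc
    by (subst add.commute[of "sum _ _" "sum _ _"], intro arg_cong2[where f = "(+)"] sum.cong)
      (auto simp: of_nat_diff cis_cnj algebra_simps)
  finally show ?thesis by simp
qed

lemma laurent_curve_support: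
  assumes N: "N > 0" and c: "c \<noteq> 0" and top: "a (2*N+1) \<noteq> 0 \<or> b (2*N+1) \<noteq> 0"
  shows "laurent_curve (2 * N + 2)
    (smult (1 / 2) (Zpoly N c \<gamma> + Wpoly N c \<gamma>)) (smult (- \<i> / 2) (Zpoly N c \<gamma> - Wpoly N c \<gamma>))
    (\<lambda>\<theta>. p \<theta> * cos \<theta> - p' \<theta> * sin \<theta>) (\<lambda>\<theta>. p \<theta> * sin \<theta> + p' \<theta> * cos \<theta>)"
    (is "laurent_curve ?m (smult _ (?Z + ?W)) (smult _ (?Z - ?W)) ?x ?y")
proof -
  have \<gamma>N: "\<gamma> N \<noteq> 0" using top by (auto simp: \<gamma>_eq complex_eq_iff)
  have diff_eq: "?Z - ?W = ?Z + smult (- 1) ?W" by simp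
  \<comment> \<open>Only Z reaches degree 4N + 4, so no multiple of W can cancel its top term;
    likewise only W has a constant term.\<close>
  have deg: "degree (?Z + smult e ?W) = 2 * ?m" for e
  proof (rule antisym)
    show "degree (?Z + smult e ?W) \<le> 2 * ?m"
      using degree_Zpoly[of N c \<gamma>] degree_Wpoly[of N c \<gamma>]
      by (intro degree_add_le order_trans[OF degree_smult_le]) auto
    have "coeff (?Z + smult e ?W) (4 * N + 4) \<noteq> 0"
      using N \<gamma>N by (simp add: coeff_Zpoly_top coeff_Wpoly_top)
    from le_degree[OF this] show "2 * ?m \<le> degree (?Z + smult e ?W)" by simp
  qed
  have const: "poly (?Z + smult e ?W) 0 \<noteq> 0" if "e \<noteq> 0" for e
    using N \<gamma>N that by (simp add: poly_0_coeff_0 coeff_Zpoly_0 coeff_Wpoly_0)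
  interpret P: balanced_laurent ?m "smult (1 / 2) (?Z + ?W)"
    using deg[of 1] const[of 1] by unfold_locales simp_all
  interpret Q: balanced_laurent ?m "smult (- \<i> / 2) (?Z - ?W)"
    using deg[of "-1"] const[of "-1"] by unfold_locales simp_all
  show ?thesis
  proof unfold_locales
    fix t :: complex
    \<comment> \<open>After substituting -t^2 times the derivative of W for that of Z, both sides
      are (1 - t^4)/2 times the former.\<close>
    show "(1 + t\<^sup>2) * poly (laurent_diff ?m (smult (1 / 2) (?Z + ?W))) t
        = \<i> * (t\<^sup>2 - 1) * poly (laurent_diff ?m (smult (- \<i> / 2) (?Z - ?W))) t"
      unfolding diff_eq laurent_diff_smult laurent_diff_add poly_smult poly_add Zpoly_Wpoly_tangent
      by (simp add: algebra_simps)
    assume t: "t \<noteq> 0" and P: "poly (smult (1 / 2) (?Z + ?W)) (- t) = poly (smult (1 / 2) (?Z + ?W)) t"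
    show "poly (smult (- \<i> / 2) (?Z - ?W)) (- t) \<noteq> poly (smult (- \<i> / 2) (?Z - ?W)) t"
    proof
      assume Q: "poly (smult (- \<i> / 2) (?Z - ?W)) (- t) = poly (smult (- \<i> / 2) (?Z - ?W)) t"
      \<comment> \<open>Recovers Z as x + i y, so coincidence at t and -t would contradict
        \<open>Zpoly_uminus\<close>.\<close>
      have eq: "poly ?Z s = poly (smult (1 / 2) (?Z + ?W)) s + \<i> * poly (smult (- \<i> / 2) (?Z - ?W)) s" for s
        by (simp add: field_simps)
      have "poly ?Z (- t) = poly ?Z t" by (simp only: eq P Q)
      then show False using Zpoly_uminus[of N c \<gamma> t] t c by simp
    qed
  next
    fix \<theta> :: real
    show "laurent ?m (smult (1 / 2) (?Z + ?W)) (cis \<theta>) = of_real (?x \<theta>)"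
      unfolding laurent_smult laurent_add laurent_Zpoly_cis laurent_Wpoly_cis
      by (simp add: complex_eq_iff)
    show "laurent ?m (smult (- \<i> / 2) (?Z - ?W)) (cis \<theta>) = of_real (?y \<theta>)"
      unfolding diff_eq laurent_smult laurent_add laurent_Zpoly_cis laurent_Wpoly_cis
      by (simp add: complex_eq_iff)
  qed simp
qed

end

section \<open>The circle case and the degree theorem\<close>

lemma is_circle_image:
  assumes "r > 0"
  shows "is_circle ((\<lambda>\<theta>. (u + r * cos \<theta>, v + r * sin \<theta>)) ` {-pi..pi})"
  unfolding is_circle_def
proof (intro exI conjI)
  show "(\<lambda>\<theta>. (u + r * cos \<theta>, v + r * sin \<theta>)) ` {-pi..pi} = {(x, y). (x - u)\<^sup>2 + (y - v)\<^sup>2 = r\<^sup>2}"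
  proof (intro equalityI subsetI)
    fix q assume "q \<in> (\<lambda>\<theta>. (u + r * cos \<theta>, v + r * sin \<theta>)) ` {-pi..pi}"
    then show "q \<in> {(x, y). (x - u)\<^sup>2 + (y - v)\<^sup>2 = r\<^sup>2}"
      by (auto simp: power_mult_distrib simp flip: distrib_left)
  next
    fix q assume "q \<in> {(x, y). (x - u)\<^sup>2 + (y - v)\<^sup>2 = r\<^sup>2}"
    then obtain x y where q: "q = (x, y)" and eq: "(x - u)\<^sup>2 + (y - v)\<^sup>2 = r\<^sup>2" by auto
    \<comment> \<open>The unit vector from the centre to the point; its argument is the parameter
      sought.\<close>
    define z where "z = Complex ((x - u) / r) ((y - v) / r)"
    have "((x - u) / r)\<^sup>2 + ((y - v) / r)\<^sup>2 = 1"
      using eq assms by (simp add: power_divide flip: add_divide_distrib)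
    then have norm: "norm z = 1" by (simp add: z_def complex_norm)
    then have "z \<noteq> 0" by auto
    then have "cis (Arg z) = z" using norm by (simp add: cis_Arg sgn_eq)
    then have "cos (Arg z) = (x - u) / r" "sin (Arg z) = (y - v) / r"
      by (auto simp: z_def complex_eq_iff)
    moreover have "Arg z \<in> {-pi..pi}" using Arg_bounded[of z] by auto
    ultimately show "q \<in> (\<lambda>\<theta>. (u + r * cos \<theta>, v + r * sin \<theta>)) ` {-pi..pi}"
      using assms q by (intro image_eqI[of _ _ "Arg z"]) auto
  qed
qed (use assms in auto)

theorem theorem2p6:
  fixes N :: nat and \<alpha> :: real and a b :: "nat \<Rightarrow> real"
    and p :: "real \<Rightarrow> real" and C :: "(real \<times> real) set"
  assumes alpha_pos: "\<alpha> > 0"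
    and p_def: "p = (\<lambda>\<theta>. \<alpha> / 2 + (\<Sum>k\<le>N. a (2*k+1) * cos (real (2*k+1) * \<theta>)
                                          + b (2*k+1) * sin (real (2*k+1) * \<theta>)))"
    and support: "\<forall>\<theta>. p \<theta> + deriv (deriv p) \<theta> \<ge> 0"
    and top: "a (2*N+1) \<noteq> 0 \<or> b (2*N+1) \<noteq> 0"
    and C_def: "C = (\<lambda>\<theta>. (p \<theta> * cos \<theta> - deriv p \<theta> * sin \<theta>,
                           p \<theta> * sin \<theta> + deriv p \<theta> * cos \<theta>)) ` {-pi..pi}"
    and not_circle: "\<not> is_circle C"
  shows "(\<exists>f. defining_polynomial C f) \<and>
         (\<forall>f. defining_polynomial C f \<longrightarrow>
              total_degree f = 4*N+4 \<and> deg_x f = 4*N+4 \<and> deg_y f = 4*N+4)"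
proof -
  define p' where "p' \<theta> = (\<Sum>j\<le>N. real (2*j+1) * (b (2*j+1) * cos (real (2*j+1) * \<theta>)
                                          - a (2*j+1) * sin (real (2*j+1) * \<theta>)))" for \<theta>
  define \<gamma> where "\<gamma> j = Complex (a (2*j+1) / 2) (- b (2*j+1) / 2)" for j
  have "(p has_real_derivative p' \<theta>) (at \<theta>)" for \<theta>
    unfolding p_def p'_def by (auto intro!: derivative_eq_intros sum.cong simp: algebra_simps)
  then have deriv_p: "deriv p = p'" by (intro ext DERIV_imp_deriv)
  have "N > 0"
  proof (rule ccontr)
    assume "\<not> N > 0"
    then have N0: "N = 0" by simp
    \<comment> \<open>For N = 0 the first harmonic only translates the circle of radius \<alpha>/2
      to the centre (a 1, b 1).\<close>
    have "(p \<theta> * cos \<theta> - deriv p \<theta> * sin \<theta>, p \<theta> * sin \<theta> + deriv p \<theta> * cos \<theta>)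
        = (a 1 + \<alpha> / 2 * cos \<theta>, b 1 + \<alpha> / 2 * sin \<theta>)" for \<theta>
    proof -
      have "a 1 * (cos \<theta> * cos \<theta>) + a 1 * (sin \<theta> * sin \<theta>) = a 1"
        "b 1 * (cos \<theta> * cos \<theta>) + b 1 * (sin \<theta> * sin \<theta>) = b 1"
        by (simp_all flip: distrib_left power2_eq_square)
      then show ?thesis unfolding deriv_p by (simp add: p_def p'_def N0 algebra_simps)
    qed
    then have "C = (\<lambda>\<theta>. (a 1 + \<alpha> / 2 * cos \<theta>, b 1 + \<alpha> / 2 * sin \<theta>)) ` {-pi..pi}"
      unfolding C_def by simp
    then show False using not_circle is_circle_image[of "\<alpha> / 2"] alpha_pos by simp
  qed
  then interpret laurent_curve "2 * N + 2"
    "smult (1 / 2) (Zpoly N (\<alpha> / 2) \<gamma> + Wpoly N (\<alpha> / 2) \<gamma>)"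
    "smult (- \<i> / 2) (Zpoly N (\<alpha> / 2) \<gamma> - Wpoly N (\<alpha> / 2) \<gamma>)"
    "\<lambda>\<theta>. p \<theta> * cos \<theta> - p' \<theta> * sin \<theta>" "\<lambda>\<theta>. p \<theta> * sin \<theta> + p' \<theta> * cos \<theta>"
    using alpha_pos top by (intro laurent_curve_support) (auto simp: p_def p'_def \<gamma>_def)
  have "C = curve" by (simp add: C_def curve_def deriv_p)
  then show ?thesis using defining_polynomial_degrees by simp
qed

end
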